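(* There is a universal constant $c>0$ such that the following holds for every $n\geq1$. Let $\mu$ be a probability measure on $\mathbb{R}^n$ with $\mathsf{C}_{\rm CL}(\mu)<\infty$, and let $\xi\sim\mu$. Then for every $C\in\mathcal{C}_n$, $$\Big|\|\Pi_C\|_{L^1(\mu)}-r_\mu(C)\Big|\;\leq\;\mathbf{E}\Big|\|\Pi_C(\xi)\|_2-r_\mu(C)\Big|\;\leq\; c\,\min\Big\{r_\mu(C),\ \sqrt{\mathsf{C}_{\rm CL}(\mu)\,r_\mu(C)}\Big\}.$$
   Context: $\mathcal{C}_n$ is the class of closed convex sets $C \subset \mathbb{R}^n$ containing the origin. $\Pi_C(x) = \arg\min_{y\in C}\|x-y\|_2$ is the metric projection, and $\|\Pi_C\|_{L^1(\mu)}=\mathbf{E}_{\xi\sim\mu}\|\Pi_C(\xi)\|_2$. $B_2^n$ is the closed Euclidean unit ball and $h_T(x)=\sup_{y\in T}\langle x,y\rangle$ is the support function. The typical radius is $$r_\mu(C)=\arg\max_{r\geq0}\Big\{\mathbf{E}_\mu h_{C\cap rB_2^n}(\xi)-\frac{r^2}{2}\Big\}.$$ The convex Lipschitz constant of $\mu$ is $$\mathsf{C}_{\rm CL}(\mu)=\sup\Big\{\sqrt{\mathrm{Var}_\mu(f)}\ :\ f:\mathbb{R}^n\to\mathbb{R}\text{ convex and }1\text{-Lipschitz with respect to }\|\cdot\|_2\Big\};$$ it is finite if and only if $\mathbf{E}_\mu\|\xi\|_2^2<\infty$. *)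

theory Defs
  imports "HOL-Probability.Probability"
begin

text \<open>
  The constant of the theorem must not depend on the dimension, so the dimension has to be a
  natural number that can be quantified inside a formula, and cannot be a type. All the spaces
  \<open>\<real>\<^sup>n\<close> are therefore realised inside one inner product space: finitely supported real sequences
  with the standard inner product, \<open>\<real>\<^sup>n\<close> being the sequences supported on \<open>{..<n}\<close>.
\<close>

typedef fsvec = "{x :: nat \<Rightarrow> real. finite {i. x i \<noteq> 0}}"
  morphisms coord Abs_fsvec
  by (rule exI[of _ "\<lambda>_. 0"]) simp

lemma finite_supp [simp]: "finite {i. coord x i \<noteq> 0}"
  using coord[of x] by simp

lemma fsvec_eqI: "(\<And>i. coord x i = coord y i) \<Longrightarrow> x = y"
  by (metis coord_inject ext)

instantiation fsvec :: real_vector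
begin

definition "0 = Abs_fsvec (\<lambda>_. 0)"
definition "x + y = Abs_fsvec (\<lambda>i. coord x i + coord y i)"
definition "- x = Abs_fsvec (\<lambda>i. - coord x i)"
definition "x - y = Abs_fsvec (\<lambda>i. coord x i - coord y i)"
definition "a *\<^sub>R x = Abs_fsvec (\<lambda>i. a * coord x i)"

lemma coord_zero [simp]: "coord 0 i = 0"
  by (simp add: zero_fsvec_def Abs_fsvec_inverse)

lemma coord_add [simp]: "coord (x + y) i = coord x i + coord y i"
proof -
  have "finite {i. coord x i + coord y i \<noteq> 0}"
    by (rule finite_subset[of _ "{i. coord x i \<noteq> 0} \<union> {i. coord y i \<noteq> 0}"]) auto
  then show ?thesis by (simp add: plus_fsvec_def Abs_fsvec_inverse)
qed

lemma coord_uminus [simp]: "coord (- x) i = - coord x i"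
  by (simp add: uminus_fsvec_def Abs_fsvec_inverse)

lemma coord_minus [simp]: "coord (x - y) i = coord x i - coord y i"
proof -
  have "finite {i. coord x i - coord y i \<noteq> 0}"
    by (rule finite_subset[of _ "{i. coord x i \<noteq> 0} \<union> {i. coord y i \<noteq> 0}"]) auto
  then show ?thesis by (simp add: minus_fsvec_def Abs_fsvec_inverse)
qed

lemma coord_scaleR [simp]: "coord (a *\<^sub>R x) i = a * coord x i"
proof -
  have "finite {i. a * coord x i \<noteq> 0}"
    by (rule finite_subset[of _ "{i. coord x i \<noteq> 0}"]) auto
  then show ?thesis by (simp add: scaleR_fsvec_def Abs_fsvec_inverse)
qed

instance
  by standard (auto intro!: fsvec_eqI simp: algebra_simps)

end

instantiation fsvec :: real_inner
begin

definition "inner x y = (\<Sum>i | coord x i \<noteq> 0. coord x i * coord y i)"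
definition "norm (x :: fsvec) = sqrt (inner x x)"
definition "dist (x :: fsvec) y = norm (x - y)"
definition "sgn (x :: fsvec) = x /\<^sub>R norm x"
definition [code del]:
  "(uniformity :: (fsvec \<times> fsvec) filter) = (INF e\<in>{0<..}. principal {(x, y). dist x y < e})"
definition [code del]:
  "open (U :: fsvec set) \<longleftrightarrow> (\<forall>x\<in>U. eventually (\<lambda>(x', y). x' = x \<longrightarrow> y \<in> U) uniformity)"

lemma inner_fsvec_superset:
  assumes "finite A" "{i. coord x i \<noteq> 0} \<subseteq> A"
  shows "inner x y = (\<Sum>i\<in>A. coord x i * coord y i)"
  unfolding inner_fsvec_def using assms by (intro sum.mono_neutral_left) auto

instance
proof
  fix x y z :: fsvec and r :: real
  show "dist x y = norm (x - y)" by (rule dist_fsvec_def)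
  show "sgn x = x /\<^sub>R norm x" by (rule sgn_fsvec_def)
  show "(uniformity :: (fsvec \<times> fsvec) filter) = (INF e\<in>{0<..}. principal {(x, y). dist x y < e})"
    by (rule uniformity_fsvec_def)
  show "open U \<longleftrightarrow> (\<forall>x\<in>U. \<forall>\<^sub>F (x', y) in uniformity. x' = x \<longrightarrow> y \<in> U)" for U :: "fsvec set"
    by (rule open_fsvec_def)
  show "norm x = sqrt (inner x x)" by (rule norm_fsvec_def)
  define A where "A = {i. coord x i \<noteq> 0} \<union> {i. coord y i \<noteq> 0}"
  have A: "finite A" "{i. coord x i \<noteq> 0} \<subseteq> A" "{i. coord y i \<noteq> 0} \<subseteq> A"
      "{i. coord (x + y) i \<noteq> 0} \<subseteq> A" "{i. coord (r *\<^sub>R x) i \<noteq> 0} \<subseteq> A"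
    by (auto simp: A_def)
  show "inner x y = inner y x"
    using A by (simp add: inner_fsvec_superset[of A] mult.commute)
  show "inner (x + y) z = inner x z + inner y z"
    using A by (simp add: inner_fsvec_superset[of A] distrib_right sum.distrib)
  show "inner (r *\<^sub>R x) y = r * inner x y"
    using A by (simp only: inner_fsvec_superset[of A] sum_distrib_left) (simp add: mult.assoc)
  show "0 \<le> inner x x"
    by (simp add: inner_fsvec_def sum_nonneg)
  show "inner x x = 0 \<longleftrightarrow> x = 0"
  proof
    assume "inner x x = 0"
    then have "\<forall>i\<in>{i. coord x i \<noteq> 0}. coord x i * coord x i = 0"
      unfolding inner_fsvec_def by (subst (asm) sum_nonneg_eq_0_iff) auto
    then show "x = 0" by (intro fsvec_eqI) auto
  qed (simp add: inner_fsvec_def)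
qed

end

definition rspace :: "nat \<Rightarrow> fsvec set" where
  "rspace n = {x. \<forall>i\<ge>n. coord x i = 0}"

text \<open>Sanity checks: \<open>rspace n\<close> is \<open>\<real>\<^sup>n\<close> with its Euclidean structure.\<close>

lemma inner_rspace:
  assumes "x \<in> rspace n"
  shows "inner x y = (\<Sum>i<n. coord x i * coord y i)"
  using assms by (intro inner_fsvec_superset) (auto simp: rspace_def not_le[symmetric])

lemma norm_rspace:
  assumes "x \<in> rspace n"
  shows "norm x = sqrt (\<Sum>i<n. (coord x i)\<^sup>2)"
  using inner_rspace[OF assms, of x] by (simp add: norm_eq_sqrt_inner power2_eq_square)

lemma rspace_ex1:
  fixes f :: "nat \<Rightarrow> real"
  shows "\<exists>!x. x \<in> rspace n \<and> (\<forall>i<n. coord x i = f i)"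
proof -
  have "finite {i. (if i < n then f i else 0) \<noteq> 0}"
    by (rule finite_subset[of _ "{..<n}"]) auto
  then have c: "coord (Abs_fsvec (\<lambda>i. if i < n then f i else 0)) i = (if i < n then f i else 0)" for i
    by (simp add: Abs_fsvec_inverse)
  show ?thesis
  proof (rule ex1I[of _ "Abs_fsvec (\<lambda>i. if i < n then f i else 0)"])
    show "x = Abs_fsvec (\<lambda>i. if i < n then f i else 0)"
      if "x \<in> rspace n \<and> (\<forall>i<n. coord x i = f i)" for x
      using that by (intro fsvec_eqI) (auto simp: c rspace_def)
  qed (auto simp: c rspace_def)
qed

lemma subspace_rspace: "subspace (rspace n)"
  by (auto simp: subspace_def rspace_def)

lemma abs_coord_le_norm: "\<bar>coord x i\<bar> \<le> norm x"
proof (cases "coord x i = 0")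
  case False
  then have "(coord x i)\<^sup>2 \<le> inner x x"
    unfolding inner_fsvec_def power2_eq_square
    by (intro member_le_sum[where f = "\<lambda>i. coord x i * coord x i"]) auto
  then show ?thesis
    by (simp add: norm_eq_sqrt_inner real_le_rsqrt)
qed simp

text \<open>
  Since \<open>rspace n\<close> is closed, a subset of it is closed in \<open>\<real>\<^sup>n\<close> iff it is closed in the whole type.
\<close>

lemma closed_rspace: "closed (rspace n)"
proof -
  have "bounded_linear (\<lambda>x. coord x i)" for i
    by (rule bounded_linear_intro[of _ 1]) (auto simp: abs_coord_le_norm)
  then have "closed {x. coord x i = 0}" for i
    by (intro closed_Collect_eq linear_continuous_on continuous_on_const)
  then have "closed (\<Inter>i\<in>{n..}. {x. coord x i = 0})" by auto
  also have "(\<Inter>i\<in>{n..}. {x. coord x i = 0}) = rspace n"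
    by (auto simp: rspace_def)
  finally show ?thesis .
qed

definition prob_measure_on_rspace :: "nat \<Rightarrow> fsvec measure \<Rightarrow> bool" where
  "prob_measure_on_rspace n \<mu> \<longleftrightarrow>
     prob_space \<mu> \<and> sets \<mu> = sets (restrict_space borel (rspace n))"

definition convex_class :: "nat \<Rightarrow> fsvec set set" where
  "convex_class n = {C. C \<subseteq> rspace n \<and> closed C \<and> convex C \<and> 0 \<in> C}"

definition metric_proj :: "fsvec set \<Rightarrow> fsvec \<Rightarrow> fsvec" where
  "metric_proj C x = (ARG_MIN (\<lambda>y. norm (x - y)) y. y \<in> C)"

definition proj_L1_norm :: "fsvec measure \<Rightarrow> fsvec set \<Rightarrow> real" where
  "proj_L1_norm \<mu> C = (\<integral>\<xi>. norm (metric_proj C \<xi>) \<partial>\<mu>)"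

text \<open>Real-valued supremum: meaningful for nonempty bounded \<open>T\<close>, the only case in which it is used.\<close>

definition support_fun :: "fsvec set \<Rightarrow> fsvec \<Rightarrow> real" where
  "support_fun T x = (SUP y\<in>T. inner x y)"

text \<open>
  For \<open>C\<close> contained in \<open>rspace n\<close>, intersecting with the ball of the whole type or with that of
  \<open>\<real>\<^sup>n\<close> makes no difference.
\<close>

definition typical_radius :: "fsvec measure \<Rightarrow> fsvec set \<Rightarrow> real" where
  "typical_radius \<mu> C =
     (ARG_MAX (\<lambda>r. (\<integral>\<xi>. support_fun (C \<inter> cball 0 r) \<xi> \<partial>\<mu>) - r\<^sup>2 / 2) r. 0 \<le> r)"

text \<open>
  The variance of a function that is not square integrable is infinite; the case distinction is
  needed because the Bochner integral of a non-integrable function is \<open>0\<close>. (On a probability space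
  square integrability implies integrability.)
\<close>

definition std_dev :: "fsvec measure \<Rightarrow> (fsvec \<Rightarrow> real) \<Rightarrow> ennreal" where
  "std_dev \<mu> f =
     (if integrable \<mu> (\<lambda>x. (f x)\<^sup>2)
      then ennreal (sqrt (\<integral>x. (f x - (\<integral>y. f y \<partial>\<mu>))\<^sup>2 \<partial>\<mu>)) else \<infinity>)"

definition convex_lipschitz_const :: "nat \<Rightarrow> fsvec measure \<Rightarrow> ennreal" where
  "convex_lipschitz_const n \<mu> =
     (SUP f\<in>{f. convex_on (rspace n) f \<and> 1-lipschitz_on (rspace n) f}. std_dev \<mu> f)"

end

theory Submission
  imports Defs
begin

text \<open>
  For fixed \<open>x\<close> the function \<open>r \<mapsto> h\<^sub>r(x)\<close>, the support function of \<open>C \<inter> rB\<close> at \<open>x\<close>, is concave and the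
  norm \<open>p\<close> of the projection of \<open>x\<close> is the point where it has slope \<open>p\<close>. In the same way the maximiser
  \<open>R\<close> of \<open>\<^bold>E h\<^sub>r - r\<^sup>2/2\<close> is the point where \<open>\<^bold>E h\<^sub>r\<close> has slope \<open>R\<close>. If \<open>p\<close> is at distance at least
  \<open>t\<close> from \<open>R\<close>, an increment of \<open>h\<close> between \<open>R\<close> and \<open>R + t\<close> or \<open>R - t\<close> therefore differs from its mean
  by at least \<open>t\<bar>p - R\<bar>\<close>. Since \<open>h\<^sub>r\<close> is convex and \<open>r\<close>-Lipschitz in \<open>x\<close>, these deviations are of order
  \<open>R \<sigma>\<close> in mean, \<open>\<sigma>\<close> being the convex Lipschitz constant, and \<open>t = sqrt (\<sigma> R)\<close> balances the bound
  \<open>t \<^bold>E\<bar>p - R\<bar> \<le> t\<^sup>2 + 3 R \<sigma>\<close>.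
\<close>


section \<open>Coordinates and compactness in \<open>rspace n\<close>\<close>

definition unit_fsvec :: "nat \<Rightarrow> fsvec" where
  "unit_fsvec i = Abs_fsvec (\<lambda>j. if j = i then 1 else 0)"

lemma coord_unit_fsvec [simp]: "coord (unit_fsvec i) j = (if j = i then 1 else 0)"
  by (simp add: unit_fsvec_def Abs_fsvec_inverse)

lemma coord_sum [simp]: "coord (\<Sum>i\<in>I. f i) j = (\<Sum>i\<in>I. coord (f i) j)"
  by (induction I rule: infinite_finite_induct) auto

lemma rspace_expansion:
  assumes "x \<in> rspace n"
  shows "(\<Sum>i<n. coord x i *\<^sub>R unit_fsvec i) = x"
proof (rule fsvec_eqI)
  fix j
  have "coord (\<Sum>i<n. coord x i *\<^sub>R unit_fsvec i) j = (\<Sum>i<n. if i = j then coord x i else 0)"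
    unfolding coord_sum by (rule sum.cong) auto
  also have "\<dots> = coord x j"
    using assms by (simp add: rspace_def)
  finally show "coord (\<Sum>i<n. coord x i *\<^sub>R unit_fsvec i) j = coord x j" .
qed

text \<open>The type \<open>fsvec\<close> is not complete, so compactness is imported from a cube by the
  coordinate parametrisation of \<open>rspace n\<close>.\<close>

lemma compact_subset_rspace:
  assumes "S \<subseteq> rspace n" "closed S" "bounded S"
  shows "compact S"
proof -
  obtain b where b: "\<And>x. x \<in> S \<Longrightarrow> norm x \<le> b"
    using \<open>bounded S\<close> by (auto simp: bounded_iff)
  define K where "K = (PiE UNIV (\<lambda>_. {-b..b}) :: (nat \<Rightarrow> real) set)"
  define \<Phi> where "\<Phi> f = (\<Sum>i<n. f i *\<^sub>R unit_fsvec i)" for f :: "nat \<Rightarrow> real"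
  \<comment> \<open>The cube runs over all indices, so this is Tychonoff's theorem;
    \<open>\<Phi>\<close> reads only the first \<open>n\<close> coordinates.\<close>
  have "compactin (product_topology (\<lambda>_. euclidean) UNIV) K"
    unfolding K_def by (subst compactin_PiE) simp
  then have "compact K"
    by (simp add: euclidean_product_topology)
  moreover have "continuous_on K \<Phi>"
    unfolding \<Phi>_def
    by (intro continuous_intros continuous_on_subset[OF continuous_on_product_coordinates]) auto
  ultimately have "compact (\<Phi> ` K)"
    by (rule compact_continuous_image[rotated])
  moreover have "S \<subseteq> \<Phi> ` K"
  proof
    fix x assume "x \<in> S"
    then have "coord x i \<in> {-b..b}" for i
      using b[of x] abs_coord_le_norm[of x i] by auto
    moreover have "\<Phi> (coord x) = x"
      using \<open>x \<in> S\<close> assms(1) by (auto simp: \<Phi>_def rspace_expansion)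
    ultimately show "x \<in> \<Phi> ` K"
      by (intro image_eqI[of _ _ "coord x"]) (auto simp: K_def)
  qed
  ultimately show ?thesis
    using \<open>closed S\<close> by (metis compact_Int_closed inf.absorb2)
qed

section \<open>Metric projection onto a closed convex set\<close>

lemma metric_proj_closest:
  assumes "C \<in> convex_class n"
  shows "metric_proj C x \<in> C" and "\<And>y. y \<in> C \<Longrightarrow> norm (x - metric_proj C x) \<le> norm (x - y)"
proof -
  have C: "C \<subseteq> rspace n" "closed C" "0 \<in> C"
    using assms by (auto simp: convex_class_def)
  \<comment> \<open>A point of norm above \<open>2 * norm x\<close> is farther from \<open>x\<close>
    than \<open>0\<close> is, so a minimum over this compact part of \<open>C\<close> is a minimum
    over \<open>C\<close>.\<close>
  define K where "K = C \<inter> cball 0 (2 * norm x)"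
  have "compact K"
    unfolding K_def using C by (intro compact_subset_rspace[of _ n] bounded_Int closed_Int disjI2) auto
  have "0 \<in> K"
    using C by (simp add: K_def)
  have "continuous_on K (\<lambda>y. norm (x - y))"
    by (intro continuous_intros)
  then obtain m where m: "m \<in> K" "\<And>y. y \<in> K \<Longrightarrow> norm (x - m) \<le> norm (x - y)"
    using continuous_attains_inf[OF \<open>compact K\<close>] \<open>0 \<in> K\<close> by blast
  have closest: "norm (x - m) \<le> norm (x - y)" if "y \<in> C" for y
  proof (cases "norm y \<le> 2 * norm x")
    case True
    then show ?thesis using m(2) that by (simp add: K_def)
  next
    case False
    have "norm (x - m) \<le> norm x"
      using m(2)[OF \<open>0 \<in> K\<close>] by simp
    also have "\<dots> \<le> norm (x - y)"
      using False norm_triangle_ineq2[of y x] by (simp add: norm_minus_commute)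
    finally show ?thesis .
  qed
  \<comment> \<open>\<open>ARG_MIN\<close> is a Hilbert choice; the witness \<open>m\<close>
    guarantees that the chosen point is a minimiser.\<close>
  have "is_arg_min (\<lambda>y. norm (x - y)) (\<lambda>y. y \<in> C) m"
    using m(1) closest by (auto simp: is_arg_min_linorder K_def)
  then have "is_arg_min (\<lambda>y. norm (x - y)) (\<lambda>y. y \<in> C) (metric_proj C x)"
    unfolding metric_proj_def arg_min_def by (rule someI)
  then show "metric_proj C x \<in> C" "\<And>y. y \<in> C \<Longrightarrow> norm (x - metric_proj C x) \<le> norm (x - y)"
    by (auto simp: is_arg_min_linorder)
qed

text \<open>The obtuse angle criterion, on which nonexpansiveness and both slope bounds
  rest.\<close>

lemma metric_proj_inner_le_0:
  assumes "C \<in> convex_class n" "y \<in> C"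
  shows "inner (x - metric_proj C x) (y - metric_proj C x) \<le> 0"
  by (rule any_closest_point_dot)
    (use assms metric_proj_closest[OF assms(1)] in \<open>auto simp: convex_class_def dist_norm\<close>)

lemma metric_proj_nonexpansive:
  assumes "C \<in> convex_class n"
  shows "norm (metric_proj C x - metric_proj C y) \<le> norm (x - y)"
proof -
  define p q where "p = metric_proj C x" and "q = metric_proj C y"
  have "inner (x - p) (q - p) \<le> 0" "inner (y - q) (p - q) \<le> 0"
    using metric_proj_inner_le_0[OF assms] metric_proj_closest(1)[OF assms]
    by (auto simp: p_def q_def)
  \<comment> \<open>The two angle inequalities added and rearranged.\<close>
  then have "(norm (p - q))\<^sup>2 \<le> inner (x - y) (p - q)"
    by (simp add: power2_norm_eq_inner inner_diff_left inner_diff_right inner_commute)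
  also have "\<dots> \<le> norm (x - y) * norm (p - q)"
    by (rule norm_cauchy_schwarz)
  finally show ?thesis
    by (cases "p = q") (auto simp: power2_eq_square p_def q_def)
qed

lemma metric_proj_zero:
  assumes "C \<in> convex_class n"
  shows "metric_proj C 0 = 0"
  using metric_proj_closest(2)[OF assms, of 0 0] assms by (simp add: convex_class_def)

lemma norm_metric_proj_le:
  assumes "C \<in> convex_class n"
  shows "norm (metric_proj C x) \<le> norm x"
  using metric_proj_nonexpansive[OF assms, of x 0] metric_proj_zero[OF assms] by simp

lemma continuous_on_norm_metric_proj:
  assumes "C \<in> convex_class n"
  shows "continuous_on UNIV (\<lambda>x. norm (metric_proj C x))"
proof -
  have "1-lipschitz_on UNIV (metric_proj C)"
    by (rule lipschitz_onI) (auto simp: dist_norm metric_proj_nonexpansive[OF assms])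
  then show ?thesis
    by (intro continuous_on_norm lipschitz_on_continuous_on)
qed

section \<open>Support function of \<open>C \<inter> cball 0 r\<close> in the radius and in the
  point\<close>

lemma inner_le_support_fun_ball:
  assumes "y \<in> C" "norm y \<le> r"
  shows "inner x y \<le> support_fun (C \<inter> cball 0 r) x"
proof -
  have "inner x z \<le> norm x * r" if "norm z \<le> r" for z
    by (rule order_trans[OF norm_cauchy_schwarz mult_left_mono[OF that]]) simp
  then have "bdd_above (inner x ` (C \<inter> cball 0 r))"
    by (intro bdd_aboveI[of _ "norm x * r"]) auto
  then show ?thesis
    unfolding support_fun_def using assms by (intro cSUP_upper) auto
qed

text \<open>A real-valued \<open>SUP\<close> is informative only on nonempty bounded sets. The ball
  supplies the bound behind the previous rule; \<open>0\<close> supplies the nonemptiness needed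
  here. All later estimates reach the supremum through these two rules.\<close>

lemma support_fun_ball_le:
  assumes "0 \<in> C" "0 \<le> r" "\<And>y. y \<in> C \<Longrightarrow> norm y \<le> r \<Longrightarrow> inner x y \<le> b"
  shows "support_fun (C \<inter> cball 0 r) x \<le> b"
proof -
  have "0 \<in> C \<inter> cball 0 r"
    using assms by simp
  then show ?thesis
    unfolding support_fun_def using assms(3) by (intro cSUP_least) auto
qed

lemma support_fun_ball_nonneg:
  assumes "0 \<in> C" "0 \<le> r"
  shows "0 \<le> support_fun (C \<inter> cball 0 r) x"
  using inner_le_support_fun_ball[of 0 C r x] assms by simp

lemma support_fun_ball_le_norm:
  assumes "0 \<in> C" "0 \<le> r"
  shows "support_fun (C \<inter> cball 0 r) x \<le> r * norm x"
proof (rule support_fun_ball_le[OF assms])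
  fix y :: fsvec assume "norm y \<le> r"
  then have "norm x * norm y \<le> r * norm x"
    using mult_left_mono[of "norm y" r "norm x"] by (simp add: mult.commute)
  then show "inner x y \<le> r * norm x"
    using norm_cauchy_schwarz[of x y] by linarith
qed

lemma support_fun_ball_mono:
  assumes "0 \<in> C" "0 \<le> q" "q \<le> r"
  shows "support_fun (C \<inter> cball 0 q) x \<le> support_fun (C \<inter> cball 0 r) x"
  using assms by (intro support_fun_ball_le inner_le_support_fun_ball) auto

text \<open>Scaling \<open>y\<close> by \<open>q / r\<close> keeps it in \<open>C\<close>, by
  convexity with \<open>0\<close>, and brings its norm below \<open>q\<close>. The loss is the
  fraction \<open>1 - q / r\<close> of \<open>inner x y\<close>, which is at most
  \<open>r * norm x\<close>.\<close>

lemma support_fun_ball_diff_le: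
  assumes "convex C" "0 \<in> C" "0 \<le> q" "q \<le> r"
  shows "support_fun (C \<inter> cball 0 r) x - support_fun (C \<inter> cball 0 q) x \<le> (r - q) * norm x"
proof (cases "q = r")
  case False
  then have r: "0 < r" "q < r" using assms by auto
  have "support_fun (C \<inter> cball 0 r) x \<le> support_fun (C \<inter> cball 0 q) x + (r - q) * norm x"
  proof (rule support_fun_ball_le)
    fix y assume y: "y \<in> C" "norm y \<le> r"
    define l where "l = q / r"
    have l: "0 \<le> l" "l \<le> 1" "l * r = q"
      using assms r by (auto simp: l_def)
    have "l *\<^sub>R y + (1 - l) *\<^sub>R 0 \<in> C"
      using assms y l by (intro convexD) auto
    moreover have "norm (l *\<^sub>R y) \<le> q"
      using mult_left_mono[OF y(2) l(1)] l by simp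
    ultimately have 1: "inner x (l *\<^sub>R y) \<le> support_fun (C \<inter> cball 0 q) x"
      by (intro inner_le_support_fun_ball) auto
    have "inner x y \<le> r * norm x"
      using norm_cauchy_schwarz[of x y] mult_left_mono[OF y(2) norm_ge_zero[of x]]
      by (simp add: mult.commute)
    then have "(1 - l) * inner x y \<le> (1 - l) * (r * norm x)"
      using l by (intro mult_left_mono) auto
    also have "(1 - l) * (r * norm x) = (r - q) * norm x"
      by (simp add: l(3)[symmetric] algebra_simps)
    finally have "inner x y - l * inner x y \<le> (r - q) * norm x"
      by (simp add: left_diff_distrib)
    with 1 show "inner x y \<le> support_fun (C \<inter> cball 0 q) x + (r - q) * norm x"
      by simp
  qed (use assms in auto)
  then show ?thesis by simp
qed simp

text \<open>Convex combinations of points of \<open>C\<close> of norm at most \<open>q\<close> and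
  \<open>r\<close> stay in \<open>C\<close> and have norm at most the combined radius.\<close>

lemma support_fun_ball_concave:
  assumes "convex C" "0 \<in> C" "0 \<le> q" "0 \<le> r" "0 < t" "t < 1"
  shows "(1 - t) * support_fun (C \<inter> cball 0 q) x + t * support_fun (C \<inter> cball 0 r) x
    \<le> support_fun (C \<inter> cball 0 ((1 - t) * q + t * r)) x" (is "_ \<le> ?m")
proof -
  have *: "(1 - t) * inner x y + t * inner x z \<le> ?m"
    if "y \<in> C" "norm y \<le> q" "z \<in> C" "norm z \<le> r" for y z
  proof -
    have "norm ((1 - t) *\<^sub>R y + t *\<^sub>R z) \<le> (1 - t) * norm y + t * norm z"
      using assms by (intro norm_triangle_le) simp
    also have "\<dots> \<le> (1 - t) * q + t * r"
      using assms that by (intro add_mono mult_left_mono) auto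
    finally have "inner x ((1 - t) *\<^sub>R y + t *\<^sub>R z) \<le> ?m"
      using assms that by (intro inner_le_support_fun_ball convexD) auto
    then show ?thesis
      by (simp add: inner_add_right)
  qed
  \<comment> \<open>The two suprema are taken in turn: first over \<open>z\<close> with
    \<open>y\<close> fixed, then over \<open>y\<close>, each time after solving the inequality for
    the term under the supremum.\<close>
  have "support_fun (C \<inter> cball 0 r) x \<le> (?m - (1 - t) * inner x y) / t"
    if "y \<in> C" "norm y \<le> q" for y
    by (rule support_fun_ball_le) (use assms *[OF that] in \<open>auto simp: field_simps\<close>)
  then have "support_fun (C \<inter> cball 0 q) x \<le> (?m - t * support_fun (C \<inter> cball 0 r) x) / (1 - t)"
    by (intro support_fun_ball_le) (use assms in \<open>auto simp: field_simps\<close>)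
  then show ?thesis
    using assms by (simp add: field_simps)
qed

lemma support_fun_ball_lipschitz:
  assumes "0 \<in> C" "0 \<le> r"
  shows "\<bar>support_fun (C \<inter> cball 0 r) x - support_fun (C \<inter> cball 0 r) y\<bar> \<le> r * norm (x - y)"
proof -
  have *: "support_fun (C \<inter> cball 0 r) x \<le> support_fun (C \<inter> cball 0 r) y + r * norm (x - y)" for x y
  proof (rule support_fun_ball_le[OF assms])
    fix z assume z: "z \<in> C" "norm z \<le> r"
    have "inner (x - y) z \<le> norm (x - y) * norm z"
      by (rule norm_cauchy_schwarz)
    also have "\<dots> \<le> norm (x - y) * r"
      using z by (intro mult_left_mono) auto
    finally have "inner (x - y) z \<le> r * norm (x - y)"
      by (simp add: mult.commute)
    then show "inner x z \<le> support_fun (C \<inter> cball 0 r) y + r * norm (x - y)"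
      using inner_le_support_fun_ball[OF z, of y] by (simp add: inner_diff_left)
  qed
  show ?thesis
    using *[of x y] *[of y x] by (simp add: norm_minus_commute)
qed

lemma support_fun_ball_convex:
  assumes "0 \<in> C" "0 \<le> r"
  shows "convex_on UNIV (support_fun (C \<inter> cball 0 r))"
proof (rule convex_onI)
  fix t :: real and x y :: fsvec
  assume t: "t > 0" "t < 1"
  show "support_fun (C \<inter> cball 0 r) ((1 - t) *\<^sub>R x + t *\<^sub>R y)
    \<le> (1 - t) * support_fun (C \<inter> cball 0 r) x + t * support_fun (C \<inter> cball 0 r) y"
  proof (rule support_fun_ball_le[OF assms])
    fix z assume z: "z \<in> C" "norm z \<le> r"
    have "(1 - t) * inner x z + t * inner y z
      \<le> (1 - t) * support_fun (C \<inter> cball 0 r) x + t * support_fun (C \<inter> cball 0 r) y"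
      using t by (intro add_mono mult_left_mono inner_le_support_fun_ball z) auto
    then show "inner ((1 - t) *\<^sub>R x + t *\<^sub>R y) z
      \<le> (1 - t) * support_fun (C \<inter> cball 0 r) x + t * support_fun (C \<inter> cball 0 r) y"
      by (simp add: inner_add_left)
  qed
qed simp

text \<open>The next two lemmas say that \<open>norm (metric_proj C x)\<close> is a supergradient at itself of the
  concave function \<open>r \<mapsto> support_fun (C \<inter> cball 0 r) x\<close>.\<close>

lemma support_fun_ball_slope_ge:
  assumes C: "C \<in> convex_class n" and "0 \<le> q" "q \<le> r" and r: "r \<le> norm (metric_proj C x)"
  shows "norm (metric_proj C x) * (r - q)
    \<le> support_fun (C \<inter> cball 0 r) x - support_fun (C \<inter> cball 0 q) x"
proof (cases "q = r")
  case False
  define p where "p = metric_proj C x"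
  have q: "q < r" "q < norm p" "0 \<le> norm p - q"
    using assms False by (auto simp: p_def)
  have C': "convex C" "0 \<in> C" "p \<in> C"
    using C metric_proj_closest(1)[OF C] by (auto simp: convex_class_def p_def)
  have "support_fun (C \<inter> cball 0 q) x \<le> support_fun (C \<inter> cball 0 r) x - norm p * (r - q)"
  proof (rule support_fun_ball_le)
    fix y assume y: "y \<in> C" "norm y \<le> q"
    \<comment> \<open>With this weight \<open>(1 - l) * q + l * norm p = r\<close>, so the point
      between \<open>y\<close> and \<open>p\<close> competes at radius \<open>r\<close>.\<close>
    define l where "l = (r - q) / (norm p - q)"
    have l: "0 \<le> l" "l \<le> 1" "l * (norm p - q) = r - q"
      using q r by (auto simp: l_def p_def)
    have "norm ((1 - l) *\<^sub>R y + l *\<^sub>R p) \<le> (1 - l) * norm y + l * norm p"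
      using l by (intro norm_triangle_le) simp
    also have "\<dots> \<le> (1 - l) * q + l * norm p"
      using l y by (intro add_mono mult_left_mono) auto
    also have "\<dots> = r"
      using l(3) by (simp add: algebra_simps)
    finally have "inner x ((1 - l) *\<^sub>R y + l *\<^sub>R p) \<le> support_fun (C \<inter> cball 0 r) x"
      using C' y l by (intro inner_le_support_fun_ball convexD) auto
    \<comment> \<open>The obtuse angle bounds \<open>inner x (p - y)\<close> below by
      \<open>inner p (p - y)\<close>, and Cauchy-Schwarz does the rest. The fraction
      \<open>l\<close> of this gain is \<open>norm p * (r - q)\<close>.\<close>
    moreover have "norm p * (norm p - q) \<le> inner x (p - y)"
    proof -
      have "inner (x - p) (y - p) \<le> 0"
        unfolding p_def by (rule metric_proj_inner_le_0[OF C y(1)])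
      then have "inner p (p - y) \<le> inner x (p - y)"
        by (simp add: inner_diff_left inner_diff_right)
      moreover have "inner p y \<le> norm p * q"
        by (rule order_trans[OF norm_cauchy_schwarz mult_left_mono[OF y(2)]]) simp
      ultimately show ?thesis
        by (simp add: inner_diff_right right_diff_distrib power2_norm_eq_inner[symmetric] power2_eq_square)
    qed
    then have "l * (norm p * (norm p - q)) \<le> l * inner x (p - y)"
      using l by (intro mult_left_mono)
    moreover have "l * (norm p * (norm p - q)) = norm p * (r - q)"
      using l(3) by (metis mult.left_commute)
    ultimately show "inner x y \<le> support_fun (C \<inter> cball 0 r) x - norm p * (r - q)"
      by (simp add: inner_add_right inner_diff_right algebra_simps)
  qed (use C' assms in auto)
  then show ?thesis by (simp add: p_def)
qed simp

lemma support_fun_ball_slope_le: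
  assumes C: "C \<in> convex_class n" and r: "norm (metric_proj C x) \<le> r" "r \<le> q"
  shows "support_fun (C \<inter> cball 0 q) x - support_fun (C \<inter> cball 0 r) x
    \<le> norm (metric_proj C x) * (q - r)"
proof (cases "q = r")
  case False
  define p where "p = metric_proj C x"
  have q: "r < q" "norm p < q" "norm p \<le> r"
    using assms False by (auto simp: p_def)
  have C': "convex C" "0 \<in> C" "p \<in> C"
    using C metric_proj_closest(1)[OF C] by (auto simp: convex_class_def p_def)
  have "support_fun (C \<inter> cball 0 q) x \<le> support_fun (C \<inter> cball 0 r) x + norm p * (q - r)"
  proof (rule support_fun_ball_le)
    fix y assume y: "y \<in> C" "norm y \<le> q"
    \<comment> \<open>Now \<open>y\<close> is pulled back towards \<open>p\<close> to reach radius
      \<open>r\<close>. The lost fraction \<open>1 - l\<close> of \<open>inner x (y - p)\<close>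
      costs at most \<open>norm p * (q - r)\<close>.\<close>
    define l where "l = (r - norm p) / (q - norm p)"
    have l: "0 \<le> l" "l \<le> 1" "l * (q - norm p) = r - norm p"
      using q by (auto simp: l_def)
    have "norm ((1 - l) *\<^sub>R p + l *\<^sub>R y) \<le> (1 - l) * norm p + l * norm y"
      using l by (intro norm_triangle_le) simp
    also have "\<dots> \<le> (1 - l) * norm p + l * q"
      using l y by (intro add_mono mult_left_mono) auto
    also have "\<dots> = r"
      using l(3) by (simp add: algebra_simps)
    finally have "inner x ((1 - l) *\<^sub>R p + l *\<^sub>R y) \<le> support_fun (C \<inter> cball 0 r) x"
      using C' y l by (intro inner_le_support_fun_ball convexD) auto
    moreover have "inner x (y - p) \<le> norm p * (q - norm p)"
    proof -
      have "inner (x - p) (y - p) \<le> 0"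
        unfolding p_def by (rule metric_proj_inner_le_0[OF C y(1)])
      then have "inner x (y - p) \<le> inner p (y - p)"
        by (simp add: inner_diff_left inner_diff_right)
      moreover have "inner p y \<le> norm p * q"
        by (rule order_trans[OF norm_cauchy_schwarz mult_left_mono[OF y(2)]]) simp
      ultimately show ?thesis
        by (simp add: inner_diff_right right_diff_distrib power2_norm_eq_inner[symmetric] power2_eq_square)
    qed
    then have "(1 - l) * inner x (y - p) \<le> (1 - l) * (norm p * (q - norm p))"
      using l by (intro mult_left_mono) auto
    moreover have "(1 - l) * (norm p * (q - norm p)) = norm p * ((q - norm p) - l * (q - norm p))"
      by (simp add: algebra_simps)
    ultimately show "inner x y \<le> support_fun (C \<inter> cball 0 r) x + norm p * (q - r)"
      unfolding l(3) by (simp add: inner_add_right inner_diff_right algebra_simps)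
  next
    show "0 \<le> q"
      using norm_ge_zero[of p] q by linarith
  qed (use C' in auto)
  then show ?thesis by (simp add: p_def)
qed simp


section \<open>Moments and deviations under the random vector\<close>

locale projection_of_random_vector =
  prob_space \<mu> for \<mu> :: "fsvec measure" +
  fixes n :: nat and C :: "fsvec set"
  assumes sets_eq: "sets \<mu> = sets (restrict_space borel (rspace n))"
    and const_finite: "convex_lipschitz_const n \<mu> < \<infinity>"
    and C: "C \<in> convex_class n"
begin

text \<open>\<open>enn2real\<close> would send infinity to \<open>0\<close>;
  \<open>const_finite\<close> excludes that case.\<close>

definition \<sigma> :: real where
  "\<sigma> = enn2real (convex_lipschitz_const n \<mu>)"

definition R :: real where
  "R = typical_radius \<mu> C"

definition p :: "fsvec \<Rightarrow> real" where
  "p x = norm (metric_proj C x)"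

definition h :: "real \<Rightarrow> fsvec \<Rightarrow> real" where
  "h r x = support_fun (C \<inter> cball 0 r) x"

definition H :: "real \<Rightarrow> real" where
  "H r = expectation (h r)"

lemma C_convex: "convex C" and C_zero: "0 \<in> C"
  using C by (auto simp: convex_class_def)

lemma \<sigma>_nonneg: "0 \<le> \<sigma>"
  by (simp add: \<sigma>_def)

lemma p_nonneg: "0 \<le> p x"
  by (simp add: p_def)

lemma borel_measurable_continuous:
  fixes f :: "fsvec \<Rightarrow> real"
  assumes "continuous_on UNIV f"
  shows "f \<in> borel_measurable \<mu>"
proof -
  have "f \<in> borel_measurable (restrict_space borel (rspace n))"
    by (intro measurable_restrict_space1 borel_measurable_continuous_onI assms)
  then show ?thesis
    unfolding measurable_cong_sets[OF sets_eq refl] .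
qed

text \<open>\<open>std_dev\<close> is infinite without square integrability, so a finite supremum
  forces a second moment for every admissible \<open>f\<close>.\<close>

lemma convex_lipschitz_std_dev:
  assumes "convex_on (rspace n) f" "1-lipschitz_on (rspace n) f"
  shows "integrable \<mu> (\<lambda>x. (f x)\<^sup>2)" and "sqrt (expectation (\<lambda>x. (f x - expectation f)\<^sup>2)) \<le> \<sigma>"
proof -
  have le: "std_dev \<mu> f \<le> convex_lipschitz_const n \<mu>"
    unfolding convex_lipschitz_const_def using assms by (intro SUP_upper) auto
  show int: "integrable \<mu> (\<lambda>x. (f x)\<^sup>2)"
  proof (rule ccontr)
    assume "\<not> integrable \<mu> (\<lambda>x. (f x)\<^sup>2)"
    then have "std_dev \<mu> f = \<infinity>"
      by (simp add: std_dev_def)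
    then show False
      using le const_finite by simp
  qed
  have "ennreal (sqrt (expectation (\<lambda>x. (f x - expectation f)\<^sup>2))) \<le> ennreal \<sigma>"
    using le int const_finite by (simp add: std_dev_def \<sigma>_def)
  then show "sqrt (expectation (\<lambda>x. (f x - expectation f)\<^sup>2)) \<le> \<sigma>"
    using \<sigma>_nonneg by (subst (asm) ennreal_le_iff)
qed

text \<open>The norm is itself an admissible convex function. Its integrability carries over to
  \<open>p\<close> and to every \<open>h r\<close> by domination.\<close>

lemma integrable_norm: "integrable \<mu> norm"
proof -
  have "convex_on (rspace n) norm"
  proof (rule convex_onI)
    fix t :: real and x y :: fsvec
    assume "t > 0" "t < 1"
    then show "norm ((1 - t) *\<^sub>R x + t *\<^sub>R y) \<le> (1 - t) * norm x + t * norm y"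
      by (intro norm_triangle_le) simp
  qed (rule subspace_imp_convex[OF subspace_rspace])
  moreover have "1-lipschitz_on (rspace n) norm"
    by (rule lipschitz_onI) (auto simp: dist_norm norm_triangle_ineq3)
  ultimately have "integrable \<mu> (\<lambda>x. (norm x)\<^sup>2)"
    by (rule convex_lipschitz_std_dev)
  moreover have "norm \<in> borel_measurable \<mu>"
    by (rule borel_measurable_continuous) (intro continuous_on_norm continuous_on_id)
  ultimately show ?thesis
    by (rule square_integrable_imp_integrable[rotated])
qed

lemma integrable_p [simp]: "integrable \<mu> p"
proof (rule Bochner_Integration.integrable_bound[OF integrable_norm])
  show "p \<in> borel_measurable \<mu>"
    unfolding p_def[abs_def] by (rule borel_measurable_continuous[OF continuous_on_norm_metric_proj[OF C]])
qed (simp add: p_def norm_metric_proj_le[OF C])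

lemma lipschitz_h:
  assumes "0 \<le> r"
  shows "r-lipschitz_on S (h r)"
  using assms support_fun_ball_lipschitz[OF C_zero assms]
  by (intro lipschitz_onI) (auto simp: dist_norm h_def)

lemma integrable_h [simp]:
  assumes "0 \<le> r"
  shows "integrable \<mu> (h r)"
proof (rule Bochner_Integration.integrable_bound)
  show "integrable \<mu> (\<lambda>x. r * norm x)"
    using integrable_norm by simp
  show "h r \<in> borel_measurable \<mu>"
    by (rule borel_measurable_continuous[OF lipschitz_on_continuous_on[OF lipschitz_h[OF assms]]])
  show "AE x in \<mu>. norm (h r x) \<le> norm (r * norm x)"
    using support_fun_ball_nonneg[OF C_zero assms] support_fun_ball_le_norm[OF C_zero assms] assms
    by (simp add: h_def)
qed

text \<open>The variance of the absolute deviation is nonnegative.\<close>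

lemma mean_abs_deviation_le:
  assumes [simp]: "integrable \<mu> f" and sq: "integrable \<mu> (\<lambda>x. (f x)\<^sup>2)"
  shows "expectation (\<lambda>x. \<bar>f x - expectation f\<bar>) \<le> sqrt (expectation (\<lambda>x. (f x - expectation f)\<^sup>2))"
proof -
  define g where "g = (\<lambda>x. \<bar>f x - expectation f\<bar>)"
  have g: "integrable \<mu> g" "integrable \<mu> (\<lambda>x. (g x)\<^sup>2)"
    using sq by (auto simp: g_def power2_diff)
  have "0 \<le> variance g"
    by simp
  then have "(expectation g)\<^sup>2 \<le> expectation (\<lambda>x. (g x)\<^sup>2)"
    using variance_eq[OF g] by simp
  then have "expectation g \<le> sqrt (expectation (\<lambda>x. (g x)\<^sup>2))"
    by (rule real_le_rsqrt)
  then show ?thesis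
    by (simp add: g_def)
qed

text \<open>The quotient \<open>h r / r\<close> is convex and 1-Lipschitz, and scaling back yields
  the factor \<open>r\<close>. Radius \<open>0\<close> is separate because of the division; there
  \<open>h 0\<close> vanishes.\<close>

lemma h_deviation:
  assumes "0 \<le> r"
  shows "expectation (\<lambda>x. \<bar>h r x - H r\<bar>) \<le> r * \<sigma>"
proof (cases "r = 0")
  case True
  have "h 0 = (\<lambda>_. 0)"
    using support_fun_ball_nonneg[OF C_zero, of 0] support_fun_ball_le_norm[OF C_zero, of 0]
    by (intro ext) (simp add: h_def order.antisym)
  then show ?thesis
    by (simp add: True H_def)
next
  case False
  define f where "f = (\<lambda>x. h r x / r)"
  have r: "0 < r" using assms False by simp
  have "convex_on (rspace n) (\<lambda>x. (1 / r) * h r x)"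
    using r unfolding h_def
    by (intro convex_on_cmul convex_on_subset[OF support_fun_ball_convex[OF C_zero assms]])
      (auto intro: subspace_imp_convex[OF subspace_rspace])
  moreover have "1-lipschitz_on (rspace n) (\<lambda>x. (1 / r) * h r x)"
    using lipschitz_on_cmult_real[OF lipschitz_h[OF assms], of "1 / r" "rspace n"] r by simp
  ultimately have f: "integrable \<mu> (\<lambda>x. (f x)\<^sup>2)" "sqrt (expectation (\<lambda>x. (f x - expectation f)\<^sup>2)) \<le> \<sigma>"
    using convex_lipschitz_std_dev[of f] by (auto simp: f_def)
  have "integrable \<mu> f"
    using assms by (simp add: f_def)
  then have "expectation (\<lambda>x. \<bar>f x - expectation f\<bar>) \<le> \<sigma>"
    using mean_abs_deviation_le[OF _ f(1)] f(2) by linarith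
  moreover have "\<bar>f x - expectation f\<bar> = \<bar>h r x - H r\<bar> / r" for x
    using r by (simp add: f_def H_def diff_divide_distrib[symmetric])
  ultimately show ?thesis
    using r by (simp add: field_simps)
qed

section \<open>The mean support function \<open>H\<close> and its maximiser \<open>R\<close>\<close>

lemma H_diff_le:
  assumes "0 \<le> q" "q \<le> r"
  shows "H r - H q \<le> (r - q) * expectation norm" and "H q \<le> H r"
proof -
  have "h r x - h q x \<le> (r - q) * norm x" and mono: "h q x \<le> h r x" for x
    unfolding h_def
    by (intro support_fun_ball_diff_le support_fun_ball_mono C_convex C_zero assms)+
  then have "expectation (\<lambda>x. h r x - h q x) \<le> expectation (\<lambda>x. (r - q) * norm x)"
    using assms integrable_norm by (intro integral_mono) auto
  then show "H r - H q \<le> (r - q) * expectation norm"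
    using assms by (simp add: H_def)
  show "H q \<le> H r"
    unfolding H_def using assms mono by (intro integral_mono) auto
qed

lemma H_concave:
  assumes "0 \<le> q" "0 \<le> r" "0 < t" "t < 1"
  shows "(1 - t) * H q + t * H r \<le> H ((1 - t) * q + t * r)"
proof -
  have "(1 - t) * h q x + t * h r x \<le> h ((1 - t) * q + t * r) x" for x
    unfolding h_def by (intro support_fun_ball_concave C_convex C_zero assms)
  then have "expectation (\<lambda>x. (1 - t) * h q x + t * h r x) \<le> expectation (h ((1 - t) * q + t * r))"
    using assms by (intro integral_mono) auto
  then show ?thesis
    using assms by (simp add: H_def)
qed

text \<open>\<open>ARG_MAX\<close> is a choice as well, so a maximiser must be exhibited first. The
  first moment \<open>M\<close> is a Lipschitz constant of \<open>H\<close>, which gives continuity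
  and hence a maximum on a compact interval.\<close>

lemma R_maximizes: "0 \<le> R" "0 \<le> r \<Longrightarrow> H r - r\<^sup>2 / 2 \<le> H R - R\<^sup>2 / 2"
proof -
  define F where "F r = H r - r\<^sup>2 / 2" for r
  define M where "M = expectation norm"
  have M: "0 \<le> M"
    by (simp add: M_def)
  have "M-lipschitz_on {0..} H"
  proof (rule lipschitz_onI)
    fix q r :: real assume "q \<in> {0..}" "r \<in> {0..}"
    then show "dist (H q) (H r) \<le> M * dist q r"
      using H_diff_le[of q r] H_diff_le[of r q]
      by (cases "q \<le> r") (auto simp: dist_real_def M_def mult.commute)
  qed (rule M)
  then have "continuous_on {0..2 * M} F"
    unfolding F_def
    by (intro continuous_intros continuous_on_subset[OF lipschitz_on_continuous_on]) auto
  then obtain m where m: "m \<in> {0..2 * M}" "\<And>r. r \<in> {0..2 * M} \<Longrightarrow> F r \<le> F m"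
    using continuous_attains_sup[of "{0..2 * M}" F] M by fastforce
  have "F r \<le> F m" if "0 \<le> r" for r
  proof (cases "r \<le> 2 * M")
    \<comment> \<open>Beyond \<open>2 * M\<close> the quadratic term outweighs the growth
      \<open>r * M\<close>, so \<open>F\<close> is at most its value at \<open>0\<close>.\<close>
    case False
    have "H r - H 0 \<le> r * M"
      using H_diff_le(1)[of 0 r] that by (simp add: M_def)
    moreover have "r * M \<le> r * (r / 2)"
      using False that by (intro mult_left_mono) auto
    ultimately have "F r \<le> F 0"
      by (simp add: F_def power2_eq_square)
    also have "F 0 \<le> F m"
      using M by (intro m) auto
    finally show ?thesis .
  qed (use m that in auto)
  then have "is_arg_max F (\<lambda>r. 0 \<le> r) m"
    using m(1) by (simp add: is_arg_max_linorder)
  then have "is_arg_max F (\<lambda>r. 0 \<le> r) (arg_max F (\<lambda>r. 0 \<le> r))"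
    unfolding arg_max_def by (rule someI)
  moreover have "R = arg_max F (\<lambda>r. 0 \<le> r)"
    by (simp add: R_def typical_radius_def F_def[abs_def] H_def h_def[abs_def])
  ultimately have "is_arg_max F (\<lambda>r. 0 \<le> r) R"
    by simp
  then show "0 \<le> R" "0 \<le> r \<Longrightarrow> H r - r\<^sup>2 / 2 \<le> H R - R\<^sup>2 / 2"
    by (auto simp: is_arg_max_linorder F_def)
qed

text \<open>Compare the values of \<open>H r - r\<^sup>2 / 2\<close> at \<open>R\<close> and at \<open>R + t * (r - R)\<close>, and let \<open>t\<close> tend
  to \<open>0\<close>.\<close>

lemma H_supergradient:
  assumes "0 \<le> r"
  shows "H r - H R \<le> R * (r - R)"
proof -
  have *: "H r - H R \<le> R * (r - R) + t * ((r - R)\<^sup>2 / 2)" if t: "0 < t" "t < 1" for t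
  proof -
    define s where "s = (1 - t) * R + t * r"
    have "0 \<le> s"
      using assms R_maximizes(1) t by (simp add: s_def)
    have "(1 - t) * H R + t * H r \<le> H s"
      unfolding s_def by (intro H_concave R_maximizes(1) assms t)
    also have "\<dots> \<le> H R + (s\<^sup>2 / 2 - R\<^sup>2 / 2)"
      using R_maximizes(2)[OF \<open>0 \<le> s\<close>] by simp
    also have "s\<^sup>2 / 2 - R\<^sup>2 / 2 = t * (R * (r - R) + t * ((r - R)\<^sup>2 / 2))"
      by (simp add: s_def power2_eq_square field_simps)
    finally have "t * (H r - H R) \<le> t * (R * (r - R) + t * ((r - R)\<^sup>2 / 2))"
      by (simp add: algebra_simps)
    then show ?thesis
      using t by (simp only: mult_le_cancel_left_pos)
  qed
  have "((\<lambda>t. R * (r - R) + t * ((r - R)\<^sup>2 / 2)) \<longlongrightarrow> R * (r - R) + 0 * ((r - R)\<^sup>2 / 2)) (at_right 0)"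
    by (intro tendsto_intros)
  moreover have "\<forall>\<^sub>F t in at_right 0. H r - H R \<le> R * (r - R) + t * ((r - R)\<^sup>2 / 2)"
  proof (rule eventually_mono[OF eventually_at_right_real[OF zero_less_one]])
    show "H r - H R \<le> R * (r - R) + t * ((r - R)\<^sup>2 / 2)" if "t \<in> {0<..<1}" for t
      using that by (intro *) auto
  qed
  ultimately show ?thesis
    by (auto dest!: tendsto_lowerbound)
qed

section \<open>Distance between \<open>p\<close> and \<open>R\<close>\<close>

lemma slope_ge:
  assumes "0 \<le> q" "q \<le> r" "r \<le> p x"
  shows "p x * (r - q) \<le> h r x - h q x"
  using support_fun_ball_slope_ge[OF C] assms by (simp add: p_def h_def)

lemma slope_le:
  assumes "p x \<le> r" "r \<le> q"
  shows "h q x - h r x \<le> p x * (q - r)"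
  using support_fun_ball_slope_le[OF C] assms by (simp add: p_def h_def)

text \<open>From \<open>R\<close> to \<open>R + e\<close>, \<open>h\<close> grows by at least
  \<open>e * p x\<close> where \<open>p x\<close> is at least \<open>R + e\<close>; elsewhere
  \<open>p x\<close> is below \<open>R + e\<close>. In mean the growth is at most
  \<open>e * R\<close>, so each case contributes one \<open>R\<close> as \<open>e\<close> tends to
  \<open>0\<close>.\<close>

lemma expectation_p_le: "expectation p \<le> 2 * R"
proof (rule field_le_epsilon)
  fix e :: real assume e: "0 < e"
  define r where "r = R + e"
  have r: "0 \<le> R" "0 \<le> r" "R \<le> r"
    using e R_maximizes(1) by (auto simp: r_def)
  have "e * p x \<le> (h r x - h R x) + e * r" for x
  proof (cases "r \<le> p x")
    case True
    have "0 \<le> e * r" using e r by simp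
    with slope_ge[OF r(1,3) True] show ?thesis
      by (simp add: r_def mult.commute)
  next
    case False
    then have "e * p x \<le> e * r"
      using e by (intro mult_left_mono) auto
    moreover have "h R x \<le> h r x"
      unfolding h_def by (intro support_fun_ball_mono C_zero r)
    ultimately show ?thesis by simp
  qed
  then have "expectation (\<lambda>x. e * p x) \<le> expectation (\<lambda>x. (h r x - h R x) + e * r)"
    using r by (intro integral_mono) auto
  also have "\<dots> = H r - H R + e * r"
    using r by (simp add: H_def prob_space)
  also have "\<dots> \<le> R * (r - R) + e * r"
    using H_supergradient[OF r(2)] by simp
  finally have "e * expectation p \<le> e * (2 * R + e)"
    by (simp add: r_def algebra_simps)
  then show "expectation p \<le> 2 * R + e"
    using e by (simp only: mult_le_cancel_left_pos)
qed

lemma expectation_abs_le_R: "expectation (\<lambda>x. \<bar>p x - R\<bar>) \<le> 3 * R"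
proof -
  have "expectation (\<lambda>x. \<bar>p x - R\<bar>) \<le> expectation (\<lambda>x. p x + R)"
    using p_nonneg R_maximizes(1) by (intro integral_mono) (auto simp: abs_le_iff add_increasing)
  also have "\<dots> \<le> 3 * R"
    using expectation_p_le by (simp add: prob_space)
  finally show ?thesis .
qed

lemma expectation_abs_le:
  assumes t: "0 < t" "t \<le> R"
  shows "t * expectation (\<lambda>x. \<bar>p x - R\<bar>) \<le> t\<^sup>2 + 3 * (R * \<sigma>)"
proof -
  define A where "A r x = \<bar>h r x - H r\<bar>" for r x
  have int [simp]: "integrable \<mu> (A r)" if "0 \<le> r" for r
    unfolding A_def using that by simp
  \<comment> \<open>The assumption \<open>t \<le> R\<close> keeps \<open>R - t\<close> an admissible
    radius.\<close>
  have r: "0 \<le> R" "0 \<le> R + t" "0 \<le> R - t"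
    using t by auto
  have pointwise: "t * \<bar>p x - R\<bar> \<le> t\<^sup>2 + A (R + t) x + A R x + A (R - t) x" for x
  proof -
    have A: "0 \<le> A (R + t) x" "0 \<le> A R x" "0 \<le> A (R - t) x"
      by (auto simp: A_def)
    \<comment> \<open>In the outer cases the increments of \<open>h\<close> and \<open>H\<close>
      differ by at least \<open>t * \<bar>p x - R\<bar>\<close>, which two of the deviations
      \<open>A\<close> absorb. In the middle case \<open>t\<^sup>2\<close> suffices.\<close>
    consider "R + t \<le> p x" | "p x \<le> R - t" | "\<bar>p x - R\<bar> \<le> t"
      by linarith
    then show ?thesis
    proof cases
      case 1
      have "p x * t \<le> h (R + t) x - h R x"
        using slope_ge[of R "R + t" x] 1 t r by simp
      moreover have "H (R + t) - H R \<le> R * t"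
        using H_supergradient[OF r(2)] by simp
      moreover have "t * \<bar>p x - R\<bar> = p x * t - R * t"
        using 1 t by (simp add: algebra_simps)
      ultimately show ?thesis
        using A zero_le_power2[of t] unfolding A_def by linarith
    next
      case 2
      have "h R x - h (R - t) x \<le> p x * t"
        using slope_le[of x "R - t" R] 2 t by simp
      moreover have "R * t \<le> H R - H (R - t)"
        using H_supergradient[OF r(3)] by simp
      moreover have "t * \<bar>p x - R\<bar> = R * t - p x * t"
        using 2 t by (simp add: abs_if algebra_simps)
      ultimately show ?thesis
        using A zero_le_power2[of t] unfolding A_def by linarith
    next
      case 3
      then have "t * \<bar>p x - R\<bar> \<le> t\<^sup>2"
        unfolding power2_eq_square using t by (intro mult_left_mono) auto
      with A show ?thesis by linarith
    qed
  qed
  have "t * expectation (\<lambda>x. \<bar>p x - R\<bar>) = expectation (\<lambda>x. t * \<bar>p x - R\<bar>)"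
    by simp
  also have "\<dots> \<le> expectation (\<lambda>x. t\<^sup>2 + A (R + t) x + A R x + A (R - t) x)"
    using r pointwise by (intro integral_mono) auto
  also have "\<dots> = t\<^sup>2 + expectation (A (R + t)) + expectation (A R) + expectation (A (R - t))"
    using r by (simp add: prob_space)
  \<comment> \<open>The radii \<open>R + t\<close>, \<open>R\<close> and \<open>R - t\<close> add up
    to \<open>3 * R\<close>.\<close>
  also have "\<dots> \<le> t\<^sup>2 + (R + t) * \<sigma> + R * \<sigma> + (R - t) * \<sigma>"
    unfolding A_def by (intro add_mono order_refl h_deviation r)
  also have "\<dots> = t\<^sup>2 + 3 * (R * \<sigma>)"
    by (simp add: algebra_simps)
  finally show ?thesis .
qed

lemma expectation_abs_le_sqrt: "expectation (\<lambda>x. \<bar>p x - R\<bar>) \<le> 4 * sqrt (\<sigma> * R)" (is "?E \<le> _")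
proof -
  define s where "s = sqrt (\<sigma> * R)"
  have R: "0 \<le> R" and s: "0 \<le> s" "s\<^sup>2 = R * \<sigma>"
    using R_maximizes(1) \<sigma>_nonneg by (auto simp: s_def)
  \<comment> \<open>The balancing choice \<open>t = s\<close> requires \<open>0 < s\<close> and
    \<open>s \<le> R\<close>. For larger \<open>s\<close> the bound \<open>3 * R\<close> is enough;
    for \<open>s = 0\<close> and \<open>R > 0\<close>, \<open>\<sigma>\<close> vanishes and
    \<open>t\<close> can tend to \<open>0\<close>.\<close>
  consider "R \<le> s" | "0 < s" "s \<le> R" | "s = 0" "0 < R"
    using R s by linarith
  then have "?E \<le> 4 * s"
  proof cases
    case 1
    then show ?thesis
      using expectation_abs_le_R s by linarith
  next
    case 2
    \<comment> \<open>At \<open>t = s\<close> the right-hand side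
      \<open>t\<^sup>2 + 3 * (R * \<sigma>)\<close> is \<open>4 * s\<^sup>2\<close>.\<close>
    have "s * ?E \<le> s * (4 * s)"
      using expectation_abs_le[OF 2] by (simp add: s(2)[symmetric] power2_eq_square)
    then show ?thesis
      using 2 by (simp only: mult_le_cancel_left_pos)
  next
    case 3
    have "?E \<le> 0 + e" if "0 < e" for e
    proof -
      \<comment> \<open>Any \<open>t\<close> in the interval from \<open>0\<close> to
        \<open>R\<close> now bounds the mean; \<open>min e R\<close> is such a \<open>t\<close>
        below \<open>e\<close>.\<close>
      have m: "0 < min e R" "min e R \<le> R"
        using 3 that by auto
      have "min e R * ?E \<le> min e R * min e R"
        using expectation_abs_le[OF m] s(2) 3 by (simp add: power2_eq_square)
      then have "?E \<le> min e R"
        using m by (simp only: mult_le_cancel_left_pos)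
      then show ?thesis by simp
    qed
    then have "?E \<le> 0"
      by (rule field_le_epsilon)
    then show ?thesis
      using 3 by simp
  qed
  then show ?thesis by (simp add: s_def)
qed

lemma abs_expectation_le: "\<bar>expectation p - R\<bar> \<le> expectation (\<lambda>x. \<bar>p x - R\<bar>)"
proof -
  have "expectation p - R = expectation (\<lambda>x. p x - R)"
    by (simp add: prob_space)
  then show ?thesis
    by (metis integral_abs_bound)
qed

end

theorem theorem1p8:
  shows "\<exists>c::real. c > 0 \<and>
    (\<forall>n\<ge>1. \<forall>\<mu>. prob_measure_on_rspace n \<mu> \<longrightarrow> convex_lipschitz_const n \<mu> < \<infinity> \<longrightarrow>
      (\<forall>C\<in>convex_class n.
        \<bar>proj_L1_norm \<mu> C - typical_radius \<mu> C\<bar>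
          \<le> (\<integral>\<xi>. \<bar>norm (metric_proj C \<xi>) - typical_radius \<mu> C\<bar> \<partial>\<mu>) \<and>
        (\<integral>\<xi>. \<bar>norm (metric_proj C \<xi>) - typical_radius \<mu> C\<bar> \<partial>\<mu>)
          \<le> c * min (typical_radius \<mu> C)
                    (sqrt (enn2real (convex_lipschitz_const n \<mu>) * typical_radius \<mu> C))))"
\<comment> \<open>The balanced bound has factor 4 and the crude one factor 3, so 4 serves both and
  is independent of \<open>n\<close>, \<open>\<mu>\<close> and \<open>C\<close>.\<close>
proof (intro exI[of _ 4] conjI allI impI ballI)
  fix n :: nat and \<mu> C
  assume "prob_measure_on_rspace n \<mu>" "convex_lipschitz_const n \<mu> < \<infinity>" "C \<in> convex_class n"
  then interpret projection_of_random_vector \<mu> n C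
    by (auto simp: projection_of_random_vector_def projection_of_random_vector_axioms_def
        prob_measure_on_rspace_def)
  show "\<bar>proj_L1_norm \<mu> C - typical_radius \<mu> C\<bar>
      \<le> (\<integral>\<xi>. \<bar>norm (metric_proj C \<xi>) - typical_radius \<mu> C\<bar> \<partial>\<mu>)"
    using abs_expectation_le by (simp add: proj_L1_norm_def p_def[abs_def] R_def)
  have "expectation (\<lambda>x. \<bar>p x - R\<bar>) \<le> 4 * min R (sqrt (\<sigma> * R))"
    using expectation_abs_le_R expectation_abs_le_sqrt R_maximizes(1) by (auto simp: min_def)
  then show "(\<integral>\<xi>. \<bar>norm (metric_proj C \<xi>) - typical_radius \<mu> C\<bar> \<partial>\<mu>)
      \<le> 4 * min (typical_radius \<mu> C)
        (sqrt (enn2real (convex_lipschitz_const n \<mu>) * typical_radius \<mu> C))"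
    by (simp add: p_def R_def \<sigma>_def)
qed simp

end
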